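(* Let $\nu_0=\sqrt{1-\sin^2 1}$ and $\nu_1=-\dfrac{\sin 2}{1+\cos 2}$. Let $\beta_1,\beta_2>0$ and $-1<D<C\leq 1$ be real numbers with $\nu_0(\beta_1+\beta_2\nu_1)(1-D^2)\geq (C-D)(1+|D|)$. Let $p$ be an analytic function in $\mathbb{D}$ with $p(0)=1$ and $$1+\beta_1 zp'(z)+\beta_2 z^2p''(z)\prec \frac{1+Cz}{1+Dz}.$$ Then $p(z)\prec 1+\sin z$.
   Context: $\mathbb{D}=\{z\in\mathbb{C}:|z|<1\}$. For functions $f,g$ analytic in $\mathbb{D}$, $f\prec g$ ($f$ is subordinate to $g$) means there is an analytic $w:\mathbb{D}\to\mathbb{C}$ with $w(0)=0$ and $|w(z)|\leq|z|$ such that $f(z)=g(w(z))$ for all $z\in\mathbb{D}$. Numerically $\nu_0\approx 0.540302$, $\nu_1\approx -1.55741$. *)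

theory Defs
  imports "HOL-Complex_Analysis.Complex_Analysis"
begin

definition unit_disc :: "complex set"
  where "unit_disc = ball 0 1"

text \<open>Subordination is only meant for functions analytic in the open unit disc; the values of
  \<open>f\<close> and \<open>g\<close> outside the disc are irrelevant, since \<open>w\<close> maps the disc into itself.\<close>

definition subordinate :: "(complex \<Rightarrow> complex) \<Rightarrow> (complex \<Rightarrow> complex) \<Rightarrow> bool"
    (infix "\<prec>\<^sub>s" 50)
  where "f \<prec>\<^sub>s g \<longleftrightarrow>
    (\<exists>w. w analytic_on unit_disc \<and> w 0 = 0 \<and> (\<forall>z\<in>unit_disc. norm (w z) \<le> norm z) \<and>
         (\<forall>z\<in>unit_disc. f z = g (w z)))"

definition \<nu>\<^sub>0 :: real
  where "\<nu>\<^sub>0 = sqrt (1 - (sin 1)\<^sup>2)"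

definition \<nu>\<^sub>1 :: real
  where "\<nu>\<^sub>1 = - (sin 2 / (1 + cos 2))"

end

theory Submission imports Defs begin

text \<open>With \<open>K = (C - D) / (1 - \<bar>D\<bar>)\<close> the hypothesis gives
  \<open>\<bar>\<beta>\<^sub>1 p' + \<beta>\<^sub>2 z p''\<bar> \<le> K\<close>. Along a ray, \<open>t powr (\<beta>\<^sub>1/\<beta>\<^sub>2) * p'(tz)\<close> has
  derivative \<open>t powr (\<beta>\<^sub>1/\<beta>\<^sub>2 - 1) / \<beta>\<^sub>2\<close> times this expression at \<open>tz\<close>, so integration yields
  \<open>\<bar>p'\<bar> \<le> K/\<beta>\<^sub>1 \<le> cos 1\<close> and \<open>\<bar>p - 1\<bar> \<le> \<bar>z\<bar> cos 1\<close>. On the disc of radius \<open>cos 1\<close> the derivative of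
  \<open>Arcsin\<close> is bounded by \<open>1 / sin 1\<close>, hence \<open>w = Arcsin (p - 1)\<close> satisfies
  \<open>\<bar>w\<bar> \<le> \<bar>z\<bar> cot 1 \<le> \<bar>z\<bar>\<close>.\<close>

text \<open>Mean value inequality on the convex disc of radius \<open>r\<close>: the derivative of
  \<open>Arcsin\<close> at \<open>v\<close> is \<open>1 / cos (Arcsin v)\<close>, and the square of
  that cosine is \<open>1 - v\<^sup>2\<close>, of modulus at least
  \<open>1 - r\<^sup>2\<close>.\<close>

lemma norm_Arcsin_le:
  assumes "0 \<le> r" "r < 1" "norm u \<le> r"
  shows "norm (Arcsin u) \<le> norm u / sqrt (1 - r\<^sup>2)"
proof -
  let ?B = "1 / sqrt (1 - r\<^sup>2)"
  have r2: "r\<^sup>2 < 1" using assms by (simp add: abs_square_less_1)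
  have *: "(Arcsin has_field_derivative inverse (cos (Arcsin v))) (at v within cball 0 r)
     \<and> norm (inverse (cos (Arcsin v))) \<le> ?B" if v: "v \<in> cball 0 r" for v
  proof
    have nv: "norm v \<le> r" using v by simp
    \<comment> \<open>This keeps \<open>v\<close> off the branch cuts of \<open>Arcsin\<close>,
      which lie on the real axis outside (-1, 1).\<close>
    then have "\<bar>Re v\<bar> < 1" using abs_Re_le_cmod[of v] assms by linarith
    then show "(Arcsin has_field_derivative inverse (cos (Arcsin v))) (at v within cball 0 r)"
      by (rule has_field_derivative_at_within[OF has_field_derivative_Arcsin])
    have "(norm (cos (Arcsin v)))\<^sup>2 = norm (1 - v\<^sup>2)"
      by (simp add: norm_power[symmetric] cos_squared_eq)
    moreover have "norm (1 - v\<^sup>2) \<ge> 1 - (norm v)\<^sup>2"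
      using norm_triangle_ineq2[of 1 "v\<^sup>2"] by (simp add: norm_power)
    moreover have "(norm v)\<^sup>2 \<le> r\<^sup>2" using nv by (simp add: power_mono)
    ultimately have "1 - r\<^sup>2 \<le> (norm (cos (Arcsin v)))\<^sup>2" by linarith
    then have "sqrt (1 - r\<^sup>2) \<le> norm (cos (Arcsin v))"
      by (simp add: real_le_lsqrt)
    moreover have "0 < sqrt (1 - r\<^sup>2)" using r2 by simp
    ultimately show "norm (inverse (cos (Arcsin v))) \<le> ?B"
      by (simp add: inverse_eq_divide norm_divide frac_le)
  qed
  have "norm (Arcsin u - Arcsin 0) \<le> ?B * norm (u - 0)"
    by (rule field_differentiable_bound[where S = "cball 0 r"]) (use * assms in auto)
  then show ?thesis by simp
qed

lemma Arcsin_holomorphic_unit_ball: "Arcsin holomorphic_on ball 0 1"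
proof (rule holomorphic_on_Arcsin)
  fix u :: complex assume "u \<in> ball 0 1" "Im u = 0"
  then show "\<bar>Re u\<bar> < 1" using abs_Re_le_cmod[of u] by simp
qed

lemma has_vector_derivative_of_real_mult:
  fixes z :: complex
  shows "((\<lambda>t. of_real t * z) has_vector_derivative z) (at t)"
  using has_vector_derivative_scaleR[OF DERIV_ident has_vector_derivative_const[of z "at t"]]
  by (simp add: scaleR_conv_of_real)

lemma of_real_mult_mem_unit_ball:
  fixes z :: complex
  assumes "z \<in> ball 0 1" "0 \<le> t" "t \<le> 1"
  shows "of_real t * z \<in> ball 0 1"
proof -
  have "t * norm z \<le> 1 * norm z" using assms by (intro mult_right_mono) auto
  also have "\<dots> < 1" using assms(1) by simp
  finally show ?thesis using assms(2) by (simp add: norm_mult)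
qed

text \<open>The weight \<open>t powr (a / b)\<close> is an integrating factor along the ray through
  \<open>z\<close>. The bound is assumed only away from 0 because the application obtains it by
  cancelling a factor \<open>norm z\<close>.\<close>

lemma euler_operator_bound:
  fixes f :: "complex \<Rightarrow> complex" and a b K :: real
  assumes a: "a > 0" and b: "b > 0"
    and f: "f holomorphic_on ball 0 1" and z: "z \<in> ball 0 1" "z \<noteq> 0"
    and bound: "\<And>z. z \<in> ball 0 1 \<Longrightarrow> z \<noteq> 0 \<Longrightarrow>
        norm (of_real a * f z + of_real b * z * deriv f z) \<le> K"
  shows "norm (f z) \<le> K / a"
proof -
  define c where "c = a / b"
  have c: "c > 0" using a b by (simp add: c_def)
  let ?\<phi> = "\<lambda>t. of_real (t powr c) * f (of_real t * z)"
  \<comment> \<open>The majorant: its derivative is \<open>K\<close> times the factor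
    \<open>t powr (c - 1) / b\<close> that appears in the derivative of
    \<open>?\<phi>\<close>.\<close>
  let ?\<psi> = "\<lambda>t. K / a * t powr c"
  let ?h = "\<lambda>x. of_real a * f x + of_real b * x * deriv f x"
  note inb = of_real_mult_mem_unit_ball[OF z(1)]
  have powr_cont: "continuous_on {0..1} (\<lambda>t::real. t powr c)"
    by (rule continuous_on_powr') (use c in \<open>auto intro!: continuous_intros\<close>)
  \<comment> \<open>Both functions vanish at 0, since \<open>0 powr c = 0\<close>, so the values at
    1 give the claim. Derivatives are compared only on the open interval;
    \<open>t powr (c - 1)\<close> blows up at 0 if \<open>c < 1\<close>.\<close>
  have "norm (?\<phi> 1 - ?\<phi> 0) \<le> ?\<psi> 1 - ?\<psi> 0"
  proof (rule differentiable_bound_general)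
    show "continuous_on {0..1} ?\<phi>"
      by (intro continuous_on_mult continuous_on_of_real powr_cont continuous_intros
          continuous_on_compose2[OF holomorphic_on_imp_continuous_on[OF f]])
         (use inb in auto)
    show "continuous_on {0..1} ?\<psi>"
      by (intro continuous_on_mult powr_cont continuous_intros)
    fix t :: real assume t: "0 < t" "t < 1"
    have tz: "of_real t * z \<in> ball 0 1" "of_real t * z \<noteq> 0" using inb t z by auto
    have pw: "((\<lambda>t. t powr c) has_real_derivative c * t powr (c - 1)) (at t)"
      using t by (auto intro!: derivative_eq_intros)
    \<comment> \<open>An opaque name for the power, so that \<open>field_simps\<close> treats it as
      an atom.\<close>
    define q where "q = t powr (c - 1)"
    have pwt: "t powr c = t powr (c - 1) * t" using t by (simp add: powr_diff)
    have df: "(f has_field_derivative deriv f (of_real t * z)) (at (of_real t * z))"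
      using f tz(1) by (auto intro: holomorphic_derivI)
    have ray: "((\<lambda>t. of_real t * z) has_vector_derivative z) (at t)"
      by (rule has_vector_derivative_of_real_mult)
    have fd: "((\<lambda>t. f (of_real t * z)) has_vector_derivative z * deriv f (of_real t * z)) (at t)"
      using field_vector_diff_chain_at[OF ray df] by (simp add: o_def)
    have "(?\<phi> has_vector_derivative
        of_real (t powr c) * (z * deriv f (of_real t * z))
        + of_real (c * t powr (c - 1)) * f (of_real t * z)) (at t)"
      by (rule has_vector_derivative_mult[OF has_vector_derivative_of_real fd])
         (use pw in \<open>simp add: has_real_derivative_iff_has_vector_derivative\<close>)
    moreover have "of_real (t powr c) * (z * deriv f (of_real t * z))
        + of_real (c * t powr (c - 1)) * f (of_real t * z)
        = of_real (t powr (c - 1) / b) * ?h (of_real t * z)"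
      using b unfolding pwt q_def[symmetric] by (simp add: c_def field_simps)
    ultimately show "(?\<phi> has_vector_derivative of_real (t powr (c - 1) / b) * ?h (of_real t * z)) (at t)"
      by simp
    show "(?\<psi> has_vector_derivative t powr (c - 1) / b * K) (at t)"
      unfolding has_real_derivative_iff_has_vector_derivative[symmetric]
      by (rule DERIV_cong[OF DERIV_cmult[OF pw]]) (use a b in \<open>simp add: c_def field_simps\<close>)
    have "norm (of_real (t powr (c - 1) / b) * ?h (of_real t * z))
        = t powr (c - 1) / b * norm (?h (of_real t * z))"
      using b by (simp add: norm_mult norm_divide del: of_real_divide flip: of_real_divide)
    also have "\<dots> \<le> t powr (c - 1) / b * K"
      using b by (intro mult_left_mono bound tz) auto
    finally show "norm (of_real (t powr (c - 1) / b) * ?h (of_real t * z)) \<le> t powr (c - 1) / b * K" .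
  qed auto
  then show ?thesis by simp
qed

text \<open>Mean value inequality on the segment from 0 to \<open>z\<close>. Its interior avoids 0,
  which matches the form of the bound given by \<open>euler_operator_bound\<close>.\<close>

lemma norm_diff_le_of_deriv_bound:
  fixes p :: "complex \<Rightarrow> complex"
  assumes p: "p holomorphic_on ball 0 1" and z: "z \<in> ball 0 1"
    and bound: "\<And>z. z \<in> ball 0 1 \<Longrightarrow> z \<noteq> 0 \<Longrightarrow> norm (deriv p z) \<le> M"
  shows "norm (p z - p 0) \<le> M * norm z"
proof (cases "z = 0")
  case False
  let ?\<phi> = "\<lambda>t::real. p (of_real t * z)"
  note inb = of_real_mult_mem_unit_ball[OF z]
  have "norm (?\<phi> 1 - ?\<phi> 0) \<le> M * norm z * 1 - M * norm z * 0"
  proof (rule differentiable_bound_general[where \<phi> = "\<lambda>t. M * norm z * t"])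
    show "continuous_on {0..1} ?\<phi>"
      by (intro continuous_intros
          continuous_on_compose2[OF holomorphic_on_imp_continuous_on[OF p]])
         (use inb in auto)
    show "continuous_on {0..1} (\<lambda>t. M * norm z * t)" by (intro continuous_intros)
    fix t :: real assume t: "0 < t" "t < 1"
    have tz: "of_real t * z \<in> ball 0 1" "of_real t * z \<noteq> 0" using inb t False by auto
    have dp: "(p has_field_derivative deriv p (of_real t * z)) (at (of_real t * z))"
      using p tz(1) by (auto intro: holomorphic_derivI)
    have ray: "((\<lambda>t. of_real t * z) has_vector_derivative z) (at t)"
      by (rule has_vector_derivative_of_real_mult)
    show "(?\<phi> has_vector_derivative z * deriv p (of_real t * z)) (at t)"
      using field_vector_diff_chain_at[OF ray dp] by (simp add: o_def)
    show "((\<lambda>t. M * norm z * t) has_vector_derivative M * norm z) (at t)"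
      by (auto intro!: derivative_eq_intros)
    show "norm (z * deriv p (of_real t * z)) \<le> M * norm z"
      using mult_right_mono[OF bound[OF tz], of "norm z"] by (simp add: norm_mult mult.commute)
  qed auto
  then show ?thesis by simp
qed simp

lemma nu0_eq_cos: "\<nu>\<^sub>0 = cos 1"
  using cos_gt_zero_pi[of 1] pi_gt3 by (simp add: \<nu>\<^sub>0_def cos_squared_eq[symmetric])

text \<open>In fact \<open>\<nu>\<^sub>1\<close> is -tan 1. The sign gives \<open>\<beta>\<^sub>1 +
  \<beta>\<^sub>2 * \<nu>\<^sub>1 \<le> \<beta>\<^sub>1\<close>.\<close>

lemma nu1_le_0: "\<nu>\<^sub>1 \<le> 0"
proof -
  have "sin 2 \<ge> (0::real)" using pi_gt3 by (intro sin_ge_zero) auto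
  \<comment> \<open>A weak inequality suffices, as a quotient by 0 is 0.\<close>
  moreover have "1 + cos 2 \<ge> (0::real)" using cos_ge_minus_one[of "2::real"] by linarith
  ultimately show ?thesis by (simp add: \<nu>\<^sub>1_def)
qed

text \<open>Since pi < 4, pi/2 - 1 is at most 1, and cosine decreases on [0, pi].\<close>

lemma cos_1_le_sin_1: "cos 1 \<le> sin (1::real)"
proof -
  have "cos 1 \<le> cos (pi / 2 - 1)"
    using pi_less_4 pi_gt3 by (intro cos_monotone_0_pi_le) auto
  then show ?thesis by (simp add: cos_sin_eq)
qed

text \<open>Subtracting 1 leaves \<open>(C - D) * w / (1 + D * w)\<close>, whose denominator has
  modulus at least \<open>1 - \<bar>D\<bar>\<close>. The factor \<open>norm z\<close> is kept so
  that it can be cancelled later.\<close>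

lemma norm_bound_of_subordinate_moebius:
  fixes C D :: real
  assumes D: "\<bar>D\<bar> < 1" "D < C"
    and sub: "f \<prec>\<^sub>s (\<lambda>z. (1 + of_real C * z) / (1 + of_real D * z))"
    and z: "z \<in> unit_disc"
  shows "norm (f z - 1) \<le> (C - D) / (1 - \<bar>D\<bar>) * norm z"
proof -
  obtain w where w: "norm (w z) \<le> norm z"
      "f z = (1 + of_real C * w z) / (1 + of_real D * w z)"
    using sub z unfolding subordinate_def by auto
  have "norm (w z) \<le> 1" using w(1) z by (simp add: unit_disc_def)
  then have "\<bar>D\<bar> * norm (w z) \<le> \<bar>D\<bar> * 1" by (intro mult_left_mono) auto
  moreover have "norm (1 + of_real D * w z) \<ge> 1 - \<bar>D\<bar> * norm (w z)"
    using norm_diff_ineq[of 1 "of_real D * w z"] by (simp add: norm_mult)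
  ultimately have den: "norm (1 + of_real D * w z) \<ge> 1 - \<bar>D\<bar>" by linarith
  then have "1 + of_real D * w z \<noteq> 0" using D by auto
  then have "f z - 1 = of_real (C - D) * w z / (1 + of_real D * w z)"
    unfolding w(2) by (simp add: field_simps)
  then have "norm (f z - 1) = (C - D) * norm (w z) / norm (1 + of_real D * w z)"
    using D by (simp add: norm_mult norm_divide del: of_real_diff)
  also have "\<dots> \<le> (C - D) * norm z / (1 - \<bar>D\<bar>)"
    using D w(1) den by (intro frac_le mult_left_mono) auto
  finally show ?thesis by simp
qed

theorem theorem2p3:
  fixes \<beta>\<^sub>1 \<beta>\<^sub>2 C D :: real and p :: "complex \<Rightarrow> complex"
  assumes "\<beta>\<^sub>1 > 0" and "\<beta>\<^sub>2 > 0"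
    and "-1 < D" and "D < C" and "C \<le> 1"
    and "\<nu>\<^sub>0 * (\<beta>\<^sub>1 + \<beta>\<^sub>2 * \<nu>\<^sub>1) * (1 - D\<^sup>2) \<ge> (C - D) * (1 + \<bar>D\<bar>)"
    and "p analytic_on unit_disc" and "p 0 = 1"
    and "(\<lambda>z. 1 + of_real \<beta>\<^sub>1 * z * deriv p z + of_real \<beta>\<^sub>2 * z\<^sup>2 * deriv (deriv p) z)
           \<prec>\<^sub>s (\<lambda>z. (1 + of_real C * z) / (1 + of_real D * z))"
  shows "p \<prec>\<^sub>s (\<lambda>z. 1 + sin z)"
proof -
  define K where "K = (C - D) / (1 - \<bar>D\<bar>)"
  have D: "\<bar>D\<bar> < 1" using assms by linarith
  have cs: "0 < cos (1::real)" "cos 1 < (1::real)" "0 < sin (1::real)"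
    using cos_gt_zero_pi[of 1] sin_gt_zero[of 1] cos_monotone_0_pi[of 0 1] pi_gt3 by auto
  \<comment> \<open>Cancelling \<open>1 + \<bar>D\<bar>\<close> from the hypothesis leaves a bound
    on \<open>K\<close>.\<close>
  have sq: "1 - D\<^sup>2 = (1 - \<bar>D\<bar>) * (1 + \<bar>D\<bar>)"
    by (simp add: algebra_simps power2_eq_square)
  have "(C - D) * (1 + \<bar>D\<bar>) \<le> (\<nu>\<^sub>0 * (\<beta>\<^sub>1 + \<beta>\<^sub>2 * \<nu>\<^sub>1) * (1 - \<bar>D\<bar>)) * (1 + \<bar>D\<bar>)"
    using assms(6) unfolding sq by (simp add: mult.assoc)
  then have "C - D \<le> \<nu>\<^sub>0 * (\<beta>\<^sub>1 + \<beta>\<^sub>2 * \<nu>\<^sub>1) * (1 - \<bar>D\<bar>)"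
    by (rule mult_right_le_imp_le) linarith
  then have "K \<le> \<nu>\<^sub>0 * (\<beta>\<^sub>1 + \<beta>\<^sub>2 * \<nu>\<^sub>1)" using D by (simp add: K_def divide_le_eq)
  also have "\<dots> \<le> cos 1 * \<beta>\<^sub>1"
    using nu1_le_0 assms(2) cs by (simp add: nu0_eq_cos mult_nonneg_nonpos)
  finally have K: "K / \<beta>\<^sub>1 \<le> cos 1" using assms(1) by (simp add: divide_le_eq)
  have p: "p holomorphic_on ball 0 1"
    using assms(7) by (simp add: unit_disc_def analytic_on_open)
  have dp: "deriv p holomorphic_on ball 0 1" using p by (intro holomorphic_deriv) auto
  have euler: "norm (of_real \<beta>\<^sub>1 * deriv p z + of_real \<beta>\<^sub>2 * z * deriv (deriv p) z) \<le> K"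
    if z: "z \<in> ball 0 1" "z \<noteq> 0" for z
  proof -
    let ?e = "of_real \<beta>\<^sub>1 * deriv p z + of_real \<beta>\<^sub>2 * z * deriv (deriv p) z"
    \<comment> \<open>The subordinate function minus 1 is exactly \<open>z * ?e\<close>.\<close>
    have "norm (z * ?e) \<le> K * norm z"
      using norm_bound_of_subordinate_moebius[OF D assms(4) assms(9), of z] z
      by (simp add: unit_disc_def K_def algebra_simps power2_eq_square)
    then have "norm ?e * norm z \<le> K * norm z" by (simp only: norm_mult mult.commute)
    then show ?thesis using z by simp
  qed
  \<comment> \<open>\<open>euler_operator_bound\<close> is applied to \<open>deriv p\<close>, then
    \<open>p\<close> is recovered by integration from \<open>p 0 = 1\<close>.\<close>
  have pb: "norm (p z - 1) \<le> cos 1 * norm z" if "z \<in> ball 0 1" for z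
    using norm_diff_le_of_deriv_bound[OF p that, of "cos 1"]
      order_trans[OF euler_operator_bound[OF assms(1,2) dp _ _ euler] K] assms(8) by simp
  define w where "w z = Arcsin (p z - 1)" for z
  have pr: "norm (p z - 1) \<le> cos 1" if "z \<in> ball 0 1" for z
  proof -
    have "cos 1 * norm z \<le> cos 1 * (1::real)" using that cs by (intro mult_left_mono) auto
    then show ?thesis using pb[OF that] by linarith
  qed
  show ?thesis unfolding subordinate_def
  proof (intro exI[of _ w] conjI ballI)
    have "(Arcsin \<circ> (\<lambda>z. p z - 1)) holomorphic_on ball 0 1"
    proof (rule holomorphic_on_compose_gen[OF _ Arcsin_holomorphic_unit_ball])
      show "(\<lambda>z. p z - 1) holomorphic_on ball 0 1" by (intro holomorphic_intros p)
      show "(\<lambda>z. p z - 1) ` ball 0 1 \<subseteq> ball 0 1"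
        using le_less_trans[OF pr cs(2)] by auto
    qed
    then show "w analytic_on unit_disc"
      by (simp add: unit_disc_def analytic_on_open w_def[abs_def] o_def)
    show "w 0 = 0" by (simp add: w_def assms(8))
  next
    fix z assume "z \<in> unit_disc"
    then have z: "z \<in> ball 0 1" by (simp add: unit_disc_def)
    \<comment> \<open>The radius \<open>r = cos 1\<close> makes \<open>sqrt (1 - r\<^sup>2)\<close>
      equal to \<open>sin 1\<close>.\<close>
    have "norm (w z) \<le> norm (p z - 1) / sin 1"
      using norm_Arcsin_le[of "cos 1" "p z - 1"] pr[OF z] cs
      by (simp add: w_def sin_squared_eq[symmetric])
    also have "\<dots> \<le> cos 1 * norm z / sin 1"
      using pb[OF z] cs by (intro divide_right_mono) auto
    also have "\<dots> \<le> norm z"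
      using cos_1_le_sin_1 cs by (simp add: divide_le_eq mult.commute mult_left_mono)
    finally show "norm (w z) \<le> norm z" .
    show "p z = 1 + sin (w z)" by (simp add: w_def)
  qed
qed

end
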